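(* Let $(\Lambda_1,\ldots,\Lambda_{p+1})$ be multiplicity vectors of size $n$, none of them equal to $(n)$ or to $(1,\ldots,1)$, such that the largest component of $\Lambda_1$ equals $2$, and suppose that there exists a rigid $(p+1)$-tuple of matrices with these multiplicity vectors. Then $p\le 3$. Moreover, if $p=3$, then one of the vectors $\Lambda_j$ equals $(n-1,1)$.
   Context: A multiplicity vector of size $n$ is a vector of positive integers with sum $n$, considered up to order; it is the vector of multiplicities of the distinct eigenvalues of a diagonalizable $n\times n$ matrix. For $\Lambda_j=(m_{1,j},\ldots,m_{i_j,j})$ put $d_j=n^2-\sum_i m_{i,j}^2$ (the dimension of the conjugacy class of a diagonalizable matrix with multiplicity vector $\Lambda_j$). A rigid $(p+1)$-tuple of matrices with multiplicity vectors $(\Lambda_1,\ldots,\Lambda_{p+1})$ means here: $d_1+\cdots+d_{p+1}=2n^2-2$, and the tuple is an irreducible (no common invariant subspace other than $0$ and $\mathbf C^n$) $(p+1)$-tuple of diagonalizable matrices with these multiplicity vectors and generic eigenvalues, either $A_j\in gl(n,\mathbf C)$ with $A_1+\cdots+A_{p+1}=0$, or $M_j\in GL(n,\mathbf C)$ with $M_1\cdots M_{p+1}=I$ (the statement holds in each of the two versions). Eigenvalues: for each $j$ let $\lambda_{1,j},\ldots,\lambda_{n,j}$ (additive case), resp. $\sigma_{1,j},\ldots,\sigma_{n,j}\in\mathbf C^*$ (multiplicative case), be the eigenvalues of the $j$-th matrix repeated with multiplicity; one has $\sum_{j,k}\lambda_{k,j}=0$, resp. $\prod_{j,k}\sigma_{k,j}=1$.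 They are called generic if there is no integer $\kappa$ with $1\le\kappa<n$ and no subsets $\Phi_j\subset\{1,\ldots,n\}$, all of cardinality $\kappa$, such that $\sum_{j}\sum_{k\in\Phi_j}\lambda_{k,j}=0$, resp. $\prod_j\prod_{k\in\Phi_j}\sigma_{k,j}=1$. *)

theory Defs
  imports
    "Jordan_Normal_Form.Char_Poly"
    "Jordan_Normal_Form.VS_Connect"
    "HOL-Library.Multiset"
begin

definition multiplicity_vector :: "nat \<Rightarrow> nat multiset \<Rightarrow> bool" where
  "multiplicity_vector n \<Lambda> \<longleftrightarrow> (\<forall>m \<in># \<Lambda>. 0 < m) \<and> sum_mset \<Lambda> = n"

definition class_dim :: "nat \<Rightarrow> nat multiset \<Rightarrow> int" where
  "class_dim n \<Lambda> = int n ^ 2 - (\<Sum>m \<in># \<Lambda>. int m ^ 2)"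

definition diagonalizable :: "complex mat \<Rightarrow> bool" where
  "diagonalizable A \<longleftrightarrow> (\<exists>D. diagonal_mat D \<and> similar_mat A D)"

definition eigenvalue_mset :: "complex mat \<Rightarrow> complex multiset" where
  "eigenvalue_mset A = proots (char_poly A)"

definition multiplicities :: "complex mat \<Rightarrow> nat multiset" where
  "multiplicities A =
     image_mset (count (eigenvalue_mset A)) (mset_set (set_mset (eigenvalue_mset A)))"

definition irreducible_tuple :: "nat \<Rightarrow> complex mat list \<Rightarrow> bool" where
  "irreducible_tuple n As \<longleftrightarrow>
     (\<forall>W. VectorSpace.subspace class_ring W (module_vec TYPE(complex) n) \<longrightarrow>
          (\<forall>A \<in> set As. \<forall>v \<in> W. A *\<^sub>v v \<in> W) \<longrightarrow>
          W = {0\<^sub>v n} \<or> W = carrier_vec n)"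

(* es ! j ! k is the k-th eigenvalue, with multiplicity, of the j-th matrix. *)

definition eigenvalue_lists :: "complex mat list \<Rightarrow> complex list list \<Rightarrow> bool" where
  "eigenvalue_lists As es \<longleftrightarrow> list_all2 (\<lambda>A e. mset e = eigenvalue_mset A) As es"

definition generic_additive :: "nat \<Rightarrow> complex list list \<Rightarrow> bool" where
  "generic_additive n es \<longleftrightarrow>
     \<not> (\<exists>\<kappa> \<Phi>. 1 \<le> \<kappa> \<and> \<kappa> < n \<and>
          (\<forall>j < length es. \<Phi> j \<subseteq> {..<n} \<and> card (\<Phi> j) = \<kappa>) \<and>
          (\<Sum>j < length es. \<Sum>k \<in> \<Phi> j. es ! j ! k) = 0)"

definition generic_multiplicative :: "nat \<Rightarrow> complex list list \<Rightarrow> bool" where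
  "generic_multiplicative n es \<longleftrightarrow>
     \<not> (\<exists>\<kappa> \<Phi>. 1 \<le> \<kappa> \<and> \<kappa> < n \<and>
          (\<forall>j < length es. \<Phi> j \<subseteq> {..<n} \<and> card (\<Phi> j) = \<kappa>) \<and>
          (\<Prod>j < length es. \<Prod>k \<in> \<Phi> j. es ! j ! k) = 1)"

definition realizes :: "nat \<Rightarrow> nat multiset list \<Rightarrow> complex mat list \<Rightarrow> bool" where
  "realizes n \<Lambda>s As \<longleftrightarrow>
     list_all2 (\<lambda>\<Lambda> A. A \<in> carrier_mat n n \<and> diagonalizable A \<and> multiplicities A = \<Lambda>) \<Lambda>s As"

definition rigid_additive :: "nat \<Rightarrow> nat multiset list \<Rightarrow> complex mat list \<Rightarrow> bool" where
  "rigid_additive n \<Lambda>s As \<longleftrightarrow>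
     (\<Sum>\<Lambda> \<leftarrow> \<Lambda>s. class_dim n \<Lambda>) = 2 * int n ^ 2 - 2 \<and>
     realizes n \<Lambda>s As \<and>
     foldr (+) As (0\<^sub>m n n) = 0\<^sub>m n n \<and>
     irreducible_tuple n As \<and>
     (\<exists>es. eigenvalue_lists As es \<and> generic_additive n es)"

definition rigid_multiplicative :: "nat \<Rightarrow> nat multiset list \<Rightarrow> complex mat list \<Rightarrow> bool" where
  "rigid_multiplicative n \<Lambda>s Ms \<longleftrightarrow>
     (\<Sum>\<Lambda> \<leftarrow> \<Lambda>s. class_dim n \<Lambda>) = 2 * int n ^ 2 - 2 \<and>
     realizes n \<Lambda>s Ms \<and>
     (\<forall>M \<in> set Ms. invertible_mat M) \<and>
     foldr (*) Ms (1\<^sub>m n) = 1\<^sub>m n \<and>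
     irreducible_tuple n Ms \<and>
     (\<exists>es. eigenvalue_lists Ms es \<and> generic_multiplicative n es)"

end

theory Submission
  imports Defs
begin

text \<open>
  For a multiplicity vector \<open>\<Lambda>\<^sub>j\<close> write \<open>r\<^sub>j = n - Max \<Lambda>\<^sub>j\<close>, the smallest rank of \<open>A\<^sub>j - \<mu> I\<close> over all
  scalars \<open>\<mu>\<close>. Irreducibility forces \<open>r\<^sub>2 + \<dots> + r\<^bsub>p+1\<^esub> \<ge> n\<close>: otherwise the largest eigenspaces of
  \<open>A\<^sub>2, \<dots>, A\<^bsub>p+1\<^esub>\<close> share a nonzero vector, and by the relation between the matrices this common
  eigenvector is an eigenvector of \<open>A\<^sub>1\<close> as well, so it spans an invariant line
  (\<open>irreducible_rank_inequality\<close>).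

  The rest is arithmetic. The components of \<open>\<Lambda>\<^sub>1\<close> are at most \<open>2\<close>, so \<open>d\<^sub>1 \<ge> n\<^sup>2 - 2n\<close>, and rigidity
  leaves \<open>d\<^sub>2 + \<dots> + d\<^bsub>p+1\<^esub> \<le> n\<^sup>2 + 2n - 2\<close>. On the other hand
  \<open>d\<^sub>j \<ge> n r\<^sub>j + c (n - 2 r\<^sub>j)\<close> whenever \<open>0 \<le> c \<le> r\<^sub>j\<close> (\<open>class_dim_lower_bound\<close>). If \<open>c\<close> is at most every
  \<open>r\<^sub>j\<close> with \<open>j \<ge> 2\<close> and \<open>2c \<le> n\<close>, summation and the rank inequality give
  \<open>d\<^sub>2 + \<dots> + d\<^bsub>p+1\<^esub> \<ge> (n - 2c) n + c n p = n\<^sup>2 + c (p - 2) n\<close>.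
  With \<open>c = 1\<close> the two bounds contradict each other as soon as \<open>p \<ge> 4\<close>. If none of the vectors is
  \<open>(n-1, 1)\<close>, then every \<open>r\<^sub>j\<close> is at least \<open>2\<close>, and with \<open>c = 2\<close> they contradict each other already
  for \<open>p = 3\<close>.
\<close>

section \<open>Dimensions of conjugacy classes\<close>

lemma sum_squares_le_bound_times_sum:
  assumes "\<forall>m \<in># \<Lambda>. m \<le> M"
  shows "(\<Sum>m \<in># \<Lambda>. int m ^ 2) \<le> int M * int (sum_mset \<Lambda>)"
  using assms
proof (induction \<Lambda>)
  case (add m \<Lambda>)
  have "int m * int m \<le> int M * int m"
    using add.prems by (intro mult_right_mono) auto
  then show ?case
    using add by (simp add: power2_eq_square algebra_simps)
qed simp

lemma sum_squares_le_square_sum: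
  "(\<Sum>m \<in># \<Lambda>. int m ^ 2) \<le> int (sum_mset \<Lambda>) ^ 2"
proof (induction \<Lambda>)
  case (add m \<Lambda>)
  have "int m ^ 2 + int (sum_mset \<Lambda>) ^ 2 \<le> (int m + int (sum_mset \<Lambda>)) ^ 2"
    by (simp add: power2_sum del: of_nat_sum_mset)
  then have "int m ^ 2 + (\<Sum>m \<in># \<Lambda>. int m ^ 2) \<le> (int m + int (sum_mset \<Lambda>)) ^ 2"
    using add.IH by linarith
  then show ?case
    by (simp del: of_nat_sum_mset)
qed simp

lemma multiplicity_vector_Max_le:
  assumes "multiplicity_vector n \<Lambda>" and "\<Lambda> \<noteq> {#}"
  shows "Max_mset \<Lambda> \<le> n"
proof -
  have "Max_mset \<Lambda> \<in># \<Lambda>" using assms(2) by (intro Max_in) auto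
  then have "sum_mset \<Lambda> = Max_mset \<Lambda> + sum_mset (\<Lambda> - {#Max_mset \<Lambda>#})"
    by (rule sum_mset.remove)
  moreover have "sum_mset \<Lambda> = n"
    using assms(1) unfolding multiplicity_vector_def ..
  ultimately show ?thesis by linarith
qed

lemma class_dim_ge_linear:
  assumes \<Lambda>: "multiplicity_vector n \<Lambda>" "\<Lambda> \<noteq> {#}"
  shows "class_dim n \<Lambda> \<ge> int n * int (n - Max_mset \<Lambda>)"
proof -
  have "(\<Sum>m \<in># \<Lambda>. int m ^ 2) \<le> int (Max_mset \<Lambda>) * int n"
    using sum_squares_le_bound_times_sum[of \<Lambda> "Max_mset \<Lambda>"] \<Lambda>
    by (simp add: multiplicity_vector_def del: of_nat_sum_mset)
  moreover have "Max_mset \<Lambda> \<le> n" using multiplicity_vector_Max_le[OF \<Lambda>] .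
  ultimately show ?thesis
    by (simp add: class_dim_def of_nat_diff power2_eq_square algebra_simps)
qed

text \<open>
  The components other than the largest one add up to \<open>r\<close>, so their squares contribute at most
  \<open>r\<^sup>2\<close>, as if they formed a single block: the class has at least the dimension
  \<open>n\<^sup>2 - (n - r)\<^sup>2 - r\<^sup>2\<close>. This is the sharp bound for \<open>2r \<le> n\<close>, while
  \<open>class_dim_ge_linear\<close> is the stronger one for \<open>2r > n\<close>.
\<close>

lemma class_dim_ge_quadratic:
  assumes \<Lambda>: "multiplicity_vector n \<Lambda>" "\<Lambda> \<noteq> {#}"
  defines "r \<equiv> int (n - Max_mset \<Lambda>)"
  shows "class_dim n \<Lambda> \<ge> 2 * r * (int n - r)"
proof -
  let ?rest = "\<Lambda> - {#Max_mset \<Lambda>#}"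
  have in_\<Lambda>: "Max_mset \<Lambda> \<in># \<Lambda>" using \<Lambda>(2) by (intro Max_in) auto
  have le: "Max_mset \<Lambda> \<le> n" using multiplicity_vector_Max_le[OF \<Lambda>] .
  have r: "int (sum_mset ?rest) = r"
  proof -
    have "sum_mset \<Lambda> = n"
      using \<Lambda>(1) unfolding multiplicity_vector_def ..
    then have "sum_mset ?rest = n - Max_mset \<Lambda>"
      using sum_mset.remove[OF in_\<Lambda>] by linarith
    then show ?thesis unfolding r_def by (rule arg_cong)
  qed
  have "(\<Sum>m \<in># \<Lambda>. int m ^ 2) = int (Max_mset \<Lambda>) ^ 2 + (\<Sum>m \<in># ?rest. int m ^ 2)"
    using sum_mset.insert[of "\<lambda>m. int m ^ 2" "Max_mset \<Lambda>" ?rest] in_\<Lambda>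
    by (simp only: insert_DiffM)
  also have "\<dots> \<le> (int n - r) ^ 2 + r ^ 2"
    using sum_squares_le_square_sum[of ?rest] le unfolding r by (simp add: r_def of_nat_diff)
  finally show ?thesis
    by (simp add: class_dim_def power2_eq_square algebra_simps)
qed

text \<open>
  The two previous bounds say that \<open>d \<ge> n r + max 0 (r (n - 2r))\<close>, which for \<open>c \<le> r\<close> dominates an
  affine function of \<open>r\<close>. Being affine, it can be summed over several classes when only the sum of
  the values \<open>r\<close> is known.
\<close>

lemma class_dim_lower_bound:
  assumes \<Lambda>: "multiplicity_vector n \<Lambda>" "\<Lambda> \<noteq> {#}"
  defines "r \<equiv> int (n - Max_mset \<Lambda>)"
  assumes c: "0 \<le> c" "c \<le> r"
  shows "class_dim n \<Lambda> \<ge> int n * r + c * (int n - 2 * r)"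
proof (cases "2 * r \<le> int n")
  case True
  then have "c * (int n - 2 * r) \<le> r * (int n - 2 * r)"
    using c by (intro mult_right_mono) auto
  then show ?thesis
    using class_dim_ge_quadratic[OF \<Lambda>] by (simp add: r_def algebra_simps)
next
  case False
  then have "c * (int n - 2 * r) \<le> 0"
    using c by (intro mult_nonneg_nonpos) auto
  then show ?thesis
    using class_dim_ge_linear[OF \<Lambda>] by (simp add: r_def)
qed

lemma class_dim_sum_lower_bound:
  assumes "\<forall>\<Lambda> \<in> set \<Lambda>s. multiplicity_vector n \<Lambda> \<and> \<Lambda> \<noteq> {#} \<and> c \<le> int (n - Max_mset \<Lambda>)"
    and "0 \<le> c"
  shows "(\<Sum>\<Lambda> \<leftarrow> \<Lambda>s. class_dim n \<Lambda>)
    \<ge> (int n - 2 * c) * int (\<Sum>\<Lambda> \<leftarrow> \<Lambda>s. n - Max_mset \<Lambda>) + c * int n * int (length \<Lambda>s)"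
  using assms(1)
proof (induction \<Lambda>s)
  case (Cons \<Lambda> \<Lambda>s)
  then have "class_dim n \<Lambda> \<ge> int n * int (n - Max_mset \<Lambda>) + c * (int n - 2 * int (n - Max_mset \<Lambda>))"
    using assms(2) by (intro class_dim_lower_bound) auto
  then show ?case
    using Cons by (simp add: algebra_simps)
qed simp

lemma multiplicity_vector_Max_eq:
  assumes \<Lambda>: "multiplicity_vector n \<Lambda>" "\<Lambda> \<noteq> {#}" and "Max_mset \<Lambda> = n"
  shows "\<Lambda> = {#n#}"
proof -
  have "n \<in># \<Lambda>" using assms by (metis Max_in finite_set_mset set_mset_eq_empty_iff)
  then obtain \<Lambda>' where \<Lambda>': "\<Lambda> = add_mset n \<Lambda>'"
    by (metis insert_DiffM)
  then have "\<forall>m \<in># \<Lambda>'. 0 < m" "sum_mset \<Lambda>' = 0"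
    using \<Lambda>(1) by (auto simp: multiplicity_vector_def)
  then have "\<Lambda>' = {#}" by (cases \<Lambda>') auto
  then show ?thesis using \<Lambda>' by simp
qed

lemma multiplicity_vector_Max_eq_pred:
  assumes \<Lambda>: "multiplicity_vector n \<Lambda>" "\<Lambda> \<noteq> {#}" and "n - Max_mset \<Lambda> = 1"
  shows "\<Lambda> = {#n - 1, 1#}"
proof -
  have M: "Max_mset \<Lambda> = n - 1" "1 \<le> n" using assms(3) by auto
  then have "n - 1 \<in># \<Lambda>" using \<Lambda> by (metis Max_in finite_set_mset set_mset_eq_empty_iff)
  then obtain \<Lambda>' where \<Lambda>': "\<Lambda> = add_mset (n - 1) \<Lambda>'"
    by (metis insert_DiffM)
  then have pos: "\<forall>m \<in># \<Lambda>'. 0 < m" and sum: "sum_mset \<Lambda>' = 1"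
    using \<Lambda>(1) M by (auto simp: multiplicity_vector_def)
  from sum obtain m \<Lambda>'' where m: "\<Lambda>' = add_mset m \<Lambda>''" by (cases \<Lambda>') auto
  then have "\<Lambda>'' = {#}" using pos sum by (cases \<Lambda>'') auto
  then show ?thesis using \<Lambda>' m sum by simp
qed

section \<open>Common eigenvectors\<close>

text \<open>
  The equations are padded with zero rows to a square matrix; there is at least one such row, so
  the determinant vanishes.
\<close>

lemma fewer_equations_than_unknowns:
  fixes ws :: "'a :: idom vec list"
  assumes "set ws \<subseteq> carrier_vec n" and "length ws < n"
  shows "\<exists>v \<in> carrier_vec n. v \<noteq> 0\<^sub>v n \<and> (\<forall>w \<in> set ws. w \<bullet> v = 0)"
proof -
  \<comment> \<open>Row \<open>length ws\<close> is singled out only to fit the form in which a zero row kills the determinant.\<close>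
  let ?c = "\<lambda>i. if i < length ws then ws ! i else 0\<^sub>v n"
  let ?A = "mat\<^sub>r n n (\<lambda>i. if i = length ws then 0\<^sub>v n else ?c i)"
  have "det ?A = 0"
  proof (rule det_row_0)
    show "?c \<in> {0..<n} \<rightarrow> carrier_vec n"
    proof
      fix i
      show "?c i \<in> carrier_vec n"
        using assms(1) nth_mem[of i ws] by (cases "i < length ws") auto
    qed
  qed (rule assms(2))
  then obtain v where v: "v \<in> carrier_vec n" "v \<noteq> 0\<^sub>v n" "?A *\<^sub>v v = 0\<^sub>v n"
    using det_0_iff_vec_prod_zero[of ?A n] by auto
  have "w \<bullet> v = 0" if w: "w \<in> set ws" for w
  proof -
    obtain i where i: "i < length ws" "w = ws ! i" using w by (auto simp: in_set_conv_nth)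
    have "w \<in> carrier_vec n" using w assms(1) by blast
    then have "row ?A i = w" using i assms by (subst row_mat_of_row_fun) (auto simp: carrier_vecD)
    moreover have "(?A *\<^sub>v v) $ i = row ?A i \<bullet> v" using i assms by (intro index_mult_mat_vec) auto
    moreover have "(?A *\<^sub>v v) $ i = 0" using v(3) i assms by simp
    ultimately show ?thesis by simp
  qed
  then show ?thesis using v by blast
qed

lemma proots_prod_linear_factors:
  fixes as :: "'a :: idom list"
  shows "proots (\<Prod>a \<leftarrow> as. [:- a, 1:]) = mset as"
proof (induction as)
  case (Cons a as)
  have "(\<Prod>a \<leftarrow> as. [:- a, 1:]) \<noteq> 0" by (auto simp: prod_list_zero_iff)
  then have "proots ([:- a, 1:] * (\<Prod>a \<leftarrow> as. [:- a, 1:])) = {#a#} + mset as"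
    using Cons.IH by (subst proots_mult) auto
  then show ?case by simp
qed simp

text \<open>
  If \<open>A = P D Q\<close> with \<open>D\<close> diagonal and \<open>Q = P\<^sup>-\<^sup>1\<close>, then \<open>A v = \<mu> v\<close> means that \<open>Q v\<close> vanishes in every
  position where the diagonal entry of \<open>D\<close> differs from \<open>\<mu>\<close>. So the eigenspace is cut out by the
  corresponding rows of \<open>Q\<close>, and for an eigenvalue of multiplicity \<open>m\<close> there are \<open>n - m\<close> of them. Counting
  equations replaces a dimension count for the intersection of several eigenspaces.
\<close>

lemma eigenspace_cut_out_by_equations:
  assumes A: "A \<in> carrier_mat n n" "diagonalizable A" and m: "m \<in># multiplicities A"
  shows "\<exists>\<mu> ws. length ws = n - m \<and> set ws \<subseteq> carrier_vec n \<and>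
    (\<forall>v \<in> carrier_vec n. (\<forall>w \<in> set ws. w \<bullet> v = 0) \<longrightarrow> A *\<^sub>v v = \<mu> \<cdot>\<^sub>v v)"
proof -
  obtain D where D: "diagonal_mat D" "similar_mat A D"
    using A(2) unfolding diagonalizable_def by blast
  obtain k P Q where sim: "{A, D, P, Q} \<subseteq> carrier_mat k k \<and> P * Q = 1\<^sub>m k \<and>
      Q * P = 1\<^sub>m k \<and> A = P * D * Q"
    using similar_matD[OF D(2)] by (elim exE) (rule that)
  have carrier: "{A, D, P, Q} \<subseteq> carrier_mat k k"
    using sim by (rule conjunct1)
  then have k: "k = n" using A(1) by auto
  have PQ: "D \<in> carrier_mat n n" "P \<in> carrier_mat n n" "Q \<in> carrier_mat n n"
    using carrier unfolding k by blast+
  have inv: "P * Q = 1\<^sub>m n" using sim unfolding k by (elim conjE)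
  have A_eq: "A = P * D * Q" using sim by (elim conjE)
  have ut: "upper_triangular D" using D(1) PQ(1) by (auto simp: diagonal_mat_def)
  have ev: "eigenvalue_mset A = mset (diag_mat D)"
  proof -
    have "char_poly A = (\<Prod>a \<leftarrow> diag_mat D. [:- a, 1:])"
      using char_poly_similar[OF D(2)] char_poly_upper_triangular[OF PQ(1) ut] by simp
    then show ?thesis
      unfolding eigenvalue_mset_def by (simp only: proots_prod_linear_factors)
  qed
  have "m \<in> count (eigenvalue_mset A) ` set_mset (eigenvalue_mset A)"
    using m unfolding multiplicities_def by simp
  then obtain \<mu> where "m = count (eigenvalue_mset A) \<mu>"
    by (rule imageE)
  then have \<mu>: "m = count (mset (diag_mat D)) \<mu>" unfolding ev .
  let ?I = "filter (\<lambda>i. \<mu> \<noteq> D $$ (i, i)) [0..<n]"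
  let ?ws = "map (row Q) ?I"
  have "m = length (filter (\<lambda>i. \<mu> = D $$ (i, i)) [0..<n])"
    unfolding \<mu> count_mset count_list_eq_length_filter diag_mat_def
    using PQ(1) by (simp add: filter_map o_def)
  then have "length ?ws = n - m"
    using sum_length_filter_compl[of "\<lambda>i. \<mu> = D $$ (i, i)" "[0..<n]"] by simp
  moreover have "set ?ws \<subseteq> carrier_vec n"
    using PQ(3) by auto
  moreover have "A *\<^sub>v v = \<mu> \<cdot>\<^sub>v v"
    if v: "v \<in> carrier_vec n" "\<forall>w \<in> set ?ws. w \<bullet> v = 0" for v
  proof -
    let ?u = "Q *\<^sub>v v"
    have u: "?u \<in> carrier_vec n" using PQ v by auto
    have "D *\<^sub>v ?u = \<mu> \<cdot>\<^sub>v ?u"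
    proof (rule eq_vecI)
      fix i assume "i < dim_vec (\<mu> \<cdot>\<^sub>v ?u)"
      then have i: "i < n" using PQ by simp
      have "(D *\<^sub>v ?u) $ i = (\<Sum>j = 0..<n. D $$ (i, j) * ?u $ j)"
        using i PQ(1,3) by (simp add: scalar_prod_def)
      also have "\<dots> = (\<Sum>j = 0..<n. if j = i then D $$ (i, i) * ?u $ i else 0)"
        using D(1) PQ(1) i by (intro sum.cong) (auto simp: diagonal_mat_def)
      also have "\<dots> = D $$ (i, i) * ?u $ i" using i by simp
      also have "\<dots> = \<mu> * ?u $ i"
      proof (cases "\<mu> = D $$ (i, i)")
        case False
        then have "?u $ i = 0" using v(2) i PQ(3) by auto
        then show ?thesis by simp
      qed simp
      finally show "(D *\<^sub>v ?u) $ i = (\<mu> \<cdot>\<^sub>v ?u) $ i" using i PQ by simp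
    qed (use PQ in auto)
    have "A *\<^sub>v v = P *\<^sub>v (D *\<^sub>v ?u)"
      unfolding A_eq using PQ v(1) u by (simp add: assoc_mult_mat_vec[of _ n n _ n])
    also have "\<dots> = P *\<^sub>v (\<mu> \<cdot>\<^sub>v ?u)" by (simp add: \<open>D *\<^sub>v ?u = \<mu> \<cdot>\<^sub>v ?u\<close>)
    also have "\<dots> = \<mu> \<cdot>\<^sub>v (P *\<^sub>v ?u)" using PQ(2) u by (rule mult_mat_vec)
    also have "P *\<^sub>v ?u = (P * Q) *\<^sub>v v" using PQ v(1) by (simp add: assoc_mult_mat_vec[of _ n n _ n])
    finally show ?thesis using inv v(1) by simp
  qed
  ultimately show ?thesis by blast
qed

text \<open>
  Each matrix imposes as many linear conditions as its largest eigenspace has codimension; all of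
  these together are fewer than \<open>n\<close>, so they have a common nonzero solution.
\<close>

lemma common_eigenvector_exists:
  assumes real: "realizes n \<Lambda>s As" and ne: "\<forall>\<Lambda> \<in> set \<Lambda>s. \<Lambda> \<noteq> {#}"
    and small: "(\<Sum>\<Lambda> \<leftarrow> \<Lambda>s. n - Max_mset \<Lambda>) < n"
  shows "\<exists>v \<in> carrier_vec n. v \<noteq> 0\<^sub>v n \<and> (\<forall>A \<in> set As. \<exists>\<mu>. A *\<^sub>v v = \<mu> \<cdot>\<^sub>v v)"
proof -
  have "\<exists>ws. length ws = (\<Sum>\<Lambda> \<leftarrow> \<Lambda>s. n - Max_mset \<Lambda>) \<and> set ws \<subseteq> carrier_vec n \<and>
     (\<forall>v \<in> carrier_vec n. (\<forall>w \<in> set ws. w \<bullet> v = 0) \<longrightarrow> (\<forall>A \<in> set As. \<exists>\<mu>. A *\<^sub>v v = \<mu> \<cdot>\<^sub>v v))"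
    using real[unfolded realizes_def] ne
  proof (induction rule: list_all2_induct)
    case (Cons \<Lambda> \<Lambda>s A As)
    then obtain ws where ws: "length ws = (\<Sum>\<Lambda> \<leftarrow> \<Lambda>s. n - Max_mset \<Lambda>)" "set ws \<subseteq> carrier_vec n"
      "\<forall>v \<in> carrier_vec n. (\<forall>w \<in> set ws. w \<bullet> v = 0) \<longrightarrow> (\<forall>A \<in> set As. \<exists>\<mu>. A *\<^sub>v v = \<mu> \<cdot>\<^sub>v v)"
      by auto
    have A: "A \<in> carrier_mat n n" "diagonalizable A" "Max_mset \<Lambda> \<in># multiplicities A"
      using Cons.hyps Cons.prems by auto
    obtain \<mu> us where "length us = n - Max_mset \<Lambda> \<and> set us \<subseteq> carrier_vec n \<and>
      (\<forall>v \<in> carrier_vec n. (\<forall>w \<in> set us. w \<bullet> v = 0) \<longrightarrow> A *\<^sub>v v = \<mu> \<cdot>\<^sub>v v)"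
      using eigenspace_cut_out_by_equations[OF A] by (elim exE) (rule that)
    then have us: "length us = n - Max_mset \<Lambda>" "set us \<subseteq> carrier_vec n"
      "\<forall>v \<in> carrier_vec n. (\<forall>w \<in> set us. w \<bullet> v = 0) \<longrightarrow> A *\<^sub>v v = \<mu> \<cdot>\<^sub>v v"
      by blast+
    show ?case
      using ws us by (intro exI[of _ "us @ ws"]) auto
  qed (auto intro: exI[of _ "[]"])
  then show ?thesis
    using fewer_equations_than_unknowns small by metis
qed

lemma line_is_subspace:
  fixes v :: "complex vec"
  assumes "v \<in> carrier_vec n"
  shows "VectorSpace.subspace class_ring (range (\<lambda>c. c \<cdot>\<^sub>v v)) (module_vec TYPE(complex) n)"
  unfolding VectorSpace.subspace_def submodule_def
proof (intro conjI allI impI)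
  show "range (\<lambda>c. c \<cdot>\<^sub>v v) \<subseteq> carrier (module_vec TYPE(complex) n)"
    using assms by (auto simp: module_vec_simps)
next
  fix x y assume "x \<in> range (\<lambda>c. c \<cdot>\<^sub>v v)" "y \<in> range (\<lambda>c. c \<cdot>\<^sub>v v)"
  then obtain a b where "x = a \<cdot>\<^sub>v v" "y = b \<cdot>\<^sub>v v" by auto
  then have "x + y = (a + b) \<cdot>\<^sub>v v" by (simp add: add_smult_distrib_vec)
  then show "x \<oplus>\<^bsub>module_vec TYPE(complex) n\<^esub> y \<in> range (\<lambda>c. c \<cdot>\<^sub>v v)"
    by (auto simp: module_vec_simps)
next
  have "0\<^sub>v n = 0 \<cdot>\<^sub>v v" using assms by auto
  then show "\<zero>\<^bsub>module_vec TYPE(complex) n\<^esub> \<in> range (\<lambda>c. c \<cdot>\<^sub>v v)"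
    by (auto simp: module_vec_simps)
next
  fix c x assume "x \<in> range (\<lambda>c. c \<cdot>\<^sub>v v)"
  then show "c \<odot>\<^bsub>module_vec TYPE(complex) n\<^esub> x \<in> range (\<lambda>c. c \<cdot>\<^sub>v v)"
    by (auto simp: module_vec_simps smult_smult_assoc)
qed (rule vec_vs vec_module)+

text \<open>
  A common eigenvector spans an invariant line, which for \<open>n \<ge> 2\<close> is a proper subspace: it cannot
  contain two different unit vectors.
\<close>

lemma irreducible_no_common_eigenvector:
  assumes irr: "irreducible_tuple n As" and n: "2 \<le> n"
    and As: "\<forall>A \<in> set As. A \<in> carrier_mat n n"
    and v: "v \<in> carrier_vec n" "v \<noteq> 0\<^sub>v n"
  shows "\<not> (\<forall>A \<in> set As. \<exists>\<mu>. A *\<^sub>v v = \<mu> \<cdot>\<^sub>v v)"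
proof
  assume ev: "\<forall>A \<in> set As. \<exists>\<mu>. A *\<^sub>v v = \<mu> \<cdot>\<^sub>v v"
  let ?W = "range (\<lambda>c. c \<cdot>\<^sub>v v)"
  have "A *\<^sub>v w \<in> ?W" if A: "A \<in> set As" and w: "w \<in> ?W" for A w
  proof -
    obtain c where c: "w = c \<cdot>\<^sub>v v" using w by auto
    obtain \<mu> where "A *\<^sub>v v = \<mu> \<cdot>\<^sub>v v" using ev A by auto
    then have "A *\<^sub>v w = (c * \<mu>) \<cdot>\<^sub>v v"
      using mult_mat_vec[of A n n v c] As A v c by (simp add: smult_smult_assoc)
    then show ?thesis by auto
  qed
  then have "?W = {0\<^sub>v n} \<or> ?W = carrier_vec n"
    using irr line_is_subspace[OF v(1)] unfolding irreducible_tuple_def by blast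
  moreover have "v \<in> ?W" by (rule range_eqI[of _ _ 1]) simp
  ultimately have W: "?W = carrier_vec n" using v(2) by auto
  obtain a b where a: "unit_vec n 0 = a \<cdot>\<^sub>v v" and b: "unit_vec n 1 = b \<cdot>\<^sub>v v"
    using W by (metis (no_types, lifting) imageE unit_vec_carrier)
  have "a * v $ 0 = 1" "a * v $ 1 = 0" "b * v $ 1 = 1"
    using arg_cong[OF a, of "\<lambda>x. x $ 0"] arg_cong[OF a, of "\<lambda>x. x $ 1"]
      arg_cong[OF b, of "\<lambda>x. x $ 1"] n v(1) by auto
  then show False by auto
qed

lemma eigenvector_of_sum:
  fixes v :: "'a :: field vec"
  assumes "v \<in> carrier_vec n"
    and "\<forall>A \<in> set As. A \<in> carrier_mat n n \<and> (\<exists>\<mu>. A *\<^sub>v v = \<mu> \<cdot>\<^sub>v v)"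
  shows "foldr (+) As (0\<^sub>m n n) \<in> carrier_mat n n \<and> (\<exists>\<mu>. foldr (+) As (0\<^sub>m n n) *\<^sub>v v = \<mu> \<cdot>\<^sub>v v)"
  using assms(2)
proof (induction As)
  case Nil
  have "0\<^sub>m n n *\<^sub>v v = 0 \<cdot>\<^sub>v v" using assms(1) by auto
  then show ?case by auto
next
  case (Cons A As)
  then obtain \<mu> \<nu> where "A *\<^sub>v v = \<mu> \<cdot>\<^sub>v v" "foldr (+) As (0\<^sub>m n n) *\<^sub>v v = \<nu> \<cdot>\<^sub>v v" by auto
  then have "(A + foldr (+) As (0\<^sub>m n n)) *\<^sub>v v = (\<mu> + \<nu>) \<cdot>\<^sub>v v"
    using Cons assms(1) by (simp add: add_mult_distrib_mat_vec[of _ n n] add_smult_distrib_vec)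
  then show ?case using Cons by auto
qed

lemma eigenvector_of_product:
  fixes v :: "'a :: field vec"
  assumes "v \<in> carrier_vec n"
    and "\<forall>A \<in> set As. A \<in> carrier_mat n n \<and> (\<exists>\<mu>. A *\<^sub>v v = \<mu> \<cdot>\<^sub>v v)"
  shows "foldr (*) As (1\<^sub>m n) \<in> carrier_mat n n \<and> (\<exists>\<mu>. foldr (*) As (1\<^sub>m n) *\<^sub>v v = \<mu> \<cdot>\<^sub>v v)"
  using assms(2)
proof (induction As)
  case Nil
  have "1\<^sub>m n *\<^sub>v v = 1 \<cdot>\<^sub>v v" using assms(1) by auto
  then have "\<exists>\<mu>. 1\<^sub>m n *\<^sub>v v = \<mu> \<cdot>\<^sub>v v" by (rule exI)
  then show ?case by simp
next
  case (Cons A As)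
  then obtain \<mu> \<nu> where "A *\<^sub>v v = \<mu> \<cdot>\<^sub>v v" "foldr (*) As (1\<^sub>m n) *\<^sub>v v = \<nu> \<cdot>\<^sub>v v" by auto
  then have "(A * foldr (*) As (1\<^sub>m n)) *\<^sub>v v = (\<nu> * \<mu>) \<cdot>\<^sub>v v"
    using Cons assms(1) mult_mat_vec[of A n n v]
    by (simp add: assoc_mult_mat_vec[of _ n n _ n] smult_smult_assoc)
  then show ?case using Cons by auto
qed

lemma eigenvector_of_first_summand:
  fixes v :: "'a :: field vec"
  assumes v: "v \<in> carrier_vec n" and A: "A \<in> carrier_mat n n"
    and As: "\<forall>A \<in> set As. A \<in> carrier_mat n n \<and> (\<exists>\<mu>. A *\<^sub>v v = \<mu> \<cdot>\<^sub>v v)"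
    and sum: "foldr (+) (A # As) (0\<^sub>m n n) = 0\<^sub>m n n"
  shows "\<exists>\<mu>. A *\<^sub>v v = \<mu> \<cdot>\<^sub>v v"
proof -
  obtain S \<mu> where S: "S = foldr (+) As (0\<^sub>m n n)" "S \<in> carrier_mat n n" "S *\<^sub>v v = \<mu> \<cdot>\<^sub>v v"
    using eigenvector_of_sum[OF v As] by auto
  have "A *\<^sub>v v + \<mu> \<cdot>\<^sub>v v = (A + S) *\<^sub>v v"
    using A S v by (simp add: add_mult_distrib_mat_vec)
  also have "A + S = 0\<^sub>m n n" using sum S(1) by simp
  also have "0\<^sub>m n n *\<^sub>v v = 0\<^sub>v n" using v by auto
  finally have eq: "A *\<^sub>v v + \<mu> \<cdot>\<^sub>v v = 0\<^sub>v n" .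
  have "A *\<^sub>v v = (- \<mu>) \<cdot>\<^sub>v v"
  proof (rule eq_vecI)
    fix i assume i: "i < dim_vec ((- \<mu>) \<cdot>\<^sub>v v)"
    then have "(A *\<^sub>v v + \<mu> \<cdot>\<^sub>v v) $ i = 0" using eq v by simp
    then show "(A *\<^sub>v v) $ i = ((- \<mu>) \<cdot>\<^sub>v v) $ i"
      using i A v by (simp add: eq_neg_iff_add_eq_0)
  qed (use A v in auto)
  then show ?thesis ..
qed

text \<open>
  The vector \<open>v\<close> is an eigenvector of the product of the other factors. Its eigenvalue \<open>\<mu>\<close> there cannot
  be zero, since \<open>v = \<mu> A v\<close>, and so \<open>A v = \<mu>\<^sup>-\<^sup>1 v\<close>.
\<close>

lemma eigenvector_of_first_factor:
  fixes v :: "'a :: field vec"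
  assumes v: "v \<in> carrier_vec n" "v \<noteq> 0\<^sub>v n" and A: "A \<in> carrier_mat n n"
    and As: "\<forall>A \<in> set As. A \<in> carrier_mat n n \<and> (\<exists>\<mu>. A *\<^sub>v v = \<mu> \<cdot>\<^sub>v v)"
    and prod: "foldr (*) (A # As) (1\<^sub>m n) = 1\<^sub>m n"
  shows "\<exists>\<mu>. A *\<^sub>v v = \<mu> \<cdot>\<^sub>v v"
proof -
  obtain S \<mu> where S: "S = foldr (*) As (1\<^sub>m n)" "S \<in> carrier_mat n n" "S *\<^sub>v v = \<mu> \<cdot>\<^sub>v v"
    using eigenvector_of_product[OF v(1) As] by auto
  have "v = (A * S) *\<^sub>v v" using prod S(1) v by simp
  also have "\<dots> = \<mu> \<cdot>\<^sub>v (A *\<^sub>v v)"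
    using A S v by (simp add: assoc_mult_mat_vec[of _ n n _ n] mult_mat_vec[of A n n])
  finally have eq: "v = \<mu> \<cdot>\<^sub>v (A *\<^sub>v v)" .
  have "\<mu> \<noteq> 0"
  proof
    assume "\<mu> = 0"
    moreover have "0 \<cdot>\<^sub>v (A *\<^sub>v v) = 0\<^sub>v n" using A by auto
    ultimately show False using eq v(2) by metis
  qed
  then have "inverse \<mu> \<cdot>\<^sub>v v = A *\<^sub>v v"
    by (subst eq) (simp add: smult_smult_assoc)
  then show ?thesis by metis
qed

section \<open>Rigid tuples\<close>

text \<open>
  The remaining matrices determine the first one through the additive or the multiplicative
  relation, so a common eigenvector of them is an eigenvector of the first matrix too.
\<close>

lemma irreducible_rank_inequality:
  assumes irr: "irreducible_tuple n (A # As)" and n: "2 \<le> n"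
    and real: "realizes n (\<Lambda> # \<Lambda>s) (A # As)" and ne: "\<forall>\<Lambda> \<in> set \<Lambda>s. \<Lambda> \<noteq> {#}"
    and rel: "foldr (+) (A # As) (0\<^sub>m n n) = 0\<^sub>m n n \<or> foldr (*) (A # As) (1\<^sub>m n) = 1\<^sub>m n"
  shows "n \<le> (\<Sum>\<Lambda> \<leftarrow> \<Lambda>s. n - Max_mset \<Lambda>)"
proof (rule ccontr)
  assume "\<not> n \<le> (\<Sum>\<Lambda> \<leftarrow> \<Lambda>s. n - Max_mset \<Lambda>)"
  moreover have "realizes n \<Lambda>s As" using real by (simp add: realizes_def)
  ultimately obtain v where v: "v \<in> carrier_vec n" "v \<noteq> 0\<^sub>v n"
      "\<forall>A \<in> set As. \<exists>\<mu>. A *\<^sub>v v = \<mu> \<cdot>\<^sub>v v"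
    using common_eigenvector_exists ne by (metis not_le)
  have carrier: "\<forall>B \<in> set (A # As). B \<in> carrier_mat n n"
    using list_all2_nthD2[OF real[unfolded realizes_def]] by (metis in_set_conv_nth)
  then have "\<exists>\<mu>. A *\<^sub>v v = \<mu> \<cdot>\<^sub>v v"
    using rel eigenvector_of_first_summand[of v n A As] eigenvector_of_first_factor[of v n A As] v
    by auto
  then show False
    using irreducible_no_common_eigenvector[OF irr n carrier v(1,2)] v(3) by auto
qed

theorem theorem22:
  fixes n p :: nat and \<Lambda>s :: "nat multiset list"
  assumes "length \<Lambda>s = p + 1"
    and "\<forall>\<Lambda> \<in> set \<Lambda>s. multiplicity_vector n \<Lambda> \<and> \<Lambda> \<noteq> {#n#} \<and> \<Lambda> \<noteq> replicate_mset n 1"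
    and "Max_mset (\<Lambda>s ! 0) = 2"
    and "(\<exists>As. rigid_additive n \<Lambda>s As) \<or> (\<exists>Ms. rigid_multiplicative n \<Lambda>s Ms)"
  shows "p \<le> 3 \<and> (p = 3 \<longrightarrow> {#n - 1, 1#} \<in> set \<Lambda>s)"
proof -
  obtain \<Lambda> \<Gamma>s where \<Lambda>s: "\<Lambda>s = \<Lambda> # \<Gamma>s" and len: "length \<Gamma>s = p"
    using assms(1) by (cases \<Lambda>s) auto
  have ne: "\<Delta> \<noteq> {#}" if "\<Delta> \<in> set \<Lambda>s" for \<Delta>
    using assms(2) that by (force simp: multiplicity_vector_def)
  have max_less: "Max_mset \<Delta> < n" if "\<Delta> \<in> set \<Lambda>s" for \<Delta>
    using multiplicity_vector_Max_eq multiplicity_vector_Max_le assms(2) ne that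
    by (metis le_neq_implies_less)
  have \<Lambda>: "\<Lambda> \<in> set \<Lambda>s" "Max_mset \<Lambda> = 2" "2 < n"
    using \<Lambda>s assms(3) max_less[of \<Lambda>] by auto
  define s where "s = (\<Sum>\<Delta> \<leftarrow> \<Gamma>s. n - Max_mset \<Delta>)"

  obtain As where As: "(\<Sum>\<Delta> \<leftarrow> \<Lambda>s. class_dim n \<Delta>) = 2 * int n ^ 2 - 2" "realizes n \<Lambda>s As"
      "foldr (+) As (0\<^sub>m n n) = 0\<^sub>m n n \<or> foldr (*) As (1\<^sub>m n) = 1\<^sub>m n" "irreducible_tuple n As"
    using assms(4) unfolding rigid_additive_def rigid_multiplicative_def by blast
  then obtain B Bs where "As = B # Bs"
    using \<Lambda>s by (cases As) (auto simp: realizes_def)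
  then have s: "n \<le> s"
    unfolding s_def using irreducible_rank_inequality[of n B Bs \<Lambda> \<Gamma>s] As \<Lambda>s \<Lambda> ne by auto

  have "class_dim n \<Lambda> \<ge> int n * (int n - 2)"
    using class_dim_ge_linear[of n \<Lambda>] \<Lambda> ne assms(2) by (simp add: of_nat_diff)
  then have upper: "(\<Sum>\<Delta> \<leftarrow> \<Gamma>s. class_dim n \<Delta>) \<le> int n * int n + 2 * int n - 2"
    using As(1) \<Lambda>s by (simp add: power2_eq_square algebra_simps)

  \<comment> \<open>No vector is \<open>(n)\<close>, so the dimension bound applies with \<open>c = 1\<close>.\<close>
  have "p \<le> 3"
  proof (rule ccontr)
    assume "\<not> p \<le> 3"
    have "(int n - 2 * 1) * int s + 1 * int n * int p \<le> (\<Sum>\<Delta> \<leftarrow> \<Gamma>s. class_dim n \<Delta>)"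
      unfolding s_def len[symmetric] using assms(2) \<Lambda>s ne max_less
      by (intro class_dim_sum_lower_bound) (auto simp: Suc_le_eq)
    moreover have "(int n - 2) * int n \<le> (int n - 2) * int s"
      using s \<Lambda> by (intro mult_left_mono) auto
    moreover have "int n * 4 \<le> int n * int p"
      using \<open>\<not> p \<le> 3\<close> by (intro mult_left_mono) auto
    ultimately show False using upper by (simp add: algebra_simps)
  qed
  \<comment> \<open>Without a vector \<open>(n-1, 1)\<close> the dimension bound applies with \<open>c = 2\<close>.\<close>
  moreover have "{#n - 1, 1#} \<in> set \<Lambda>s" if p: "p = 3"
  proof (rule ccontr)
    assume no: "{#n - 1, 1#} \<notin> set \<Lambda>s"
    have r2: "2 \<le> n - Max_mset \<Delta>" if \<Delta>: "\<Delta> \<in> set \<Lambda>s" for \<Delta>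
    proof -
      have "n - Max_mset \<Delta> \<noteq> 1"
        using multiplicity_vector_Max_eq_pred[of n \<Delta>] no \<Delta> ne assms(2) by auto
      then show ?thesis using max_less[OF \<Delta>] by linarith
    qed
    \<comment> \<open>The first vector is not \<open>(n-1, 1)\<close> either, so \<open>n - 2 \<ge> 2\<close> and the coefficient of \<open>s\<close> below is
      nonnegative.\<close>
    have n: "4 \<le> n" using r2[OF \<Lambda>(1)] \<Lambda>(2) by linarith
    have "int 2 \<le> int (n - Max_mset \<Delta>)" if "\<Delta> \<in> set \<Lambda>s" for \<Delta>
      using r2[OF that] by (simp only: of_nat_le_iff)
    then have "(int n - 2 * 2) * int s + 2 * int n * int p \<le> (\<Sum>\<Delta> \<leftarrow> \<Gamma>s. class_dim n \<Delta>)"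
      unfolding s_def len[symmetric] using assms(2) \<Lambda>s ne
      by (intro class_dim_sum_lower_bound) auto
    moreover have "(int n - 4) * int n \<le> (int n - 4) * int s"
      using s n by (intro mult_left_mono) auto
    ultimately show False using upper p by (simp add: algebra_simps)
  qed
  ultimately show ?thesis by blast
qed

end
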